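(* Let $Z=(Z_n)_{n\in\mathbb N}$ be a realization of model $C$ started from the all-occupied configuration $Z_0=\bullet^{\mathbb Z}$, and let $d_n=\mathbb P(Z_{0,n}=\bullet)$ (which equals $\mathbb P(Z_{k,n}=\bullet)$ for every $k\in\mathbb Z$). Let $T$ be the first time a simple symmetric random walk on $\mathbb Z$ started from $0$ reaches $2$. Then for all $n\in\mathbb N$, $$d_n=\mathbb P(T>2n)=4^{-n}\binom{2n+1}{n}.$$ In particular $d_n\sim \dfrac{2}{\sqrt{\pi n}}$ as $n\to\infty$, hence $d_n\to0$ as $n\to\infty$.
   Context: $\mathbb N=\{0,1,2,\dots\}$ and $\mathcal U=\{\uparrow,\rightarrow\}$. An update process is a family $U=(U_{i,n})_{(i,n)\in\mathbb Z\times\mathbb N}$ of i.i.d. random variables with $\mathbb P(U_{i,n}=\uparrow)=\mathbb P(U_{i,n}=\rightarrow)=1/2$; write $U_n=(U_{i,n})_{i\in\mathbb Z}$. Model $C$ (coalescing particles): define $\mathcal C:\{\circ,\bullet\}^{\mathbb Z}\times\mathcal U^{\mathbb Z}\to\{\circ,\bullet\}^{\mathbb Z}$ by $\mathcal C(z,u)=\tilde z$, where $\tilde z_i=\bullet$ if one of the following holds: $z_{i-1}z_i=\bullet\circ$ and $u_{i-1}=\rightarrow$; $z_{i-1}z_i=\circ\bullet$ and $u_i=\uparrow$; $z_{i-1}z_i=\bullet\bullet$ and $u_{i-1}u_i=\uparrow\uparrow$; $z_{i-1}z_i=\bullet\bullet$ and $u_{i-1}=\rightarrow$; and $\tilde z_i=\circ$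 otherwise. (A particle $\bullet$ at $i$ stays if $u_i=\uparrow$ and jumps to $i+1$ if $u_i=\rightarrow$; colliding particles merge.) A realization of model $C$ is a process $(Z_n)_{n\in\mathbb N}$, $Z_n=(Z_{k,n})_{k\in\mathbb Z}$, with $Z_{n+1}=\mathcal C(Z_n,U_n)$ for all $n$, where $U$ is an update process independent of $Z_0$. *)

theory Defs
  imports "HOL-Probability.Probability" "HOL-Library.Extended_Nat" "HOL-Library.Landau_Symbols"
begin

datatype update = Up | Rightward

datatype cell = Empty | Occupied

definition update_process :: "'a measure \<Rightarrow> (int \<Rightarrow> nat \<Rightarrow> 'a \<Rightarrow> update) \<Rightarrow> bool" where
  "update_process M U \<longleftrightarrow>
     prob_space.indep_vars M (\<lambda>_. count_space UNIV) (\<lambda>(i, n). U i n) UNIV \<and>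
     (\<forall>i n. measure M {\<omega> \<in> space M. U i n \<omega> = Up} = 1 / 2 \<and>
            measure M {\<omega> \<in> space M. U i n \<omega> = Rightward} = 1 / 2)"

definition coalesce :: "(int \<Rightarrow> cell) \<Rightarrow> (int \<Rightarrow> update) \<Rightarrow> int \<Rightarrow> cell" where
  "coalesce z u = (\<lambda>i.
     if z (i - 1) = Occupied \<and> z i = Empty \<and> u (i - 1) = Rightward
      \<or> z (i - 1) = Empty \<and> z i = Occupied \<and> u i = Up
      \<or> z (i - 1) = Occupied \<and> z i = Occupied \<and> u (i - 1) = Up \<and> u i = Up
      \<or> z (i - 1) = Occupied \<and> z i = Occupied \<and> u (i - 1) = Rightward
     then Occupied else Empty)"

(* Configurations carry the product sigma-algebra. Z n \<omega> i is the state of site i at time n;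
   the recursion is only required almost surely. Independence of Z 0 and U is stated for the
   generated sigma-algebras, because indep_var needs both variables to have the same type. *)
definition model_C_realization ::
  "'a measure \<Rightarrow> (int \<Rightarrow> nat \<Rightarrow> 'a \<Rightarrow> update) \<Rightarrow> (nat \<Rightarrow> 'a \<Rightarrow> int \<Rightarrow> cell) \<Rightarrow> bool" where
  "model_C_realization M U Z \<longleftrightarrow>
     update_process M U \<and>
     (\<forall>n. Z n \<in> measurable M (PiM UNIV (\<lambda>_. count_space UNIV))) \<and>
     prob_space.indep_set M
       (sets (vimage_algebra (space M) (Z 0) (PiM UNIV (\<lambda>_. count_space UNIV))))
       (sets (vimage_algebra (space M) (\<lambda>\<omega> (i, n). U i n \<omega>) (PiM UNIV (\<lambda>_. count_space UNIV)))) \<and>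
     (\<forall>n. AE \<omega> in M. Z (Suc n) \<omega> = coalesce (Z n \<omega>) (\<lambda>i. U i n \<omega>))"

definition occupied_prob :: "'a measure \<Rightarrow> (nat \<Rightarrow> 'a \<Rightarrow> int \<Rightarrow> cell) \<Rightarrow> int \<Rightarrow> nat \<Rightarrow> real" where
  "occupied_prob M Z k n = measure M {\<omega> \<in> space M. Z n \<omega> k = Occupied}"

definition simple_symmetric_random_walk :: "'a measure \<Rightarrow> (nat \<Rightarrow> 'a \<Rightarrow> int) \<Rightarrow> bool" where
  "simple_symmetric_random_walk N S \<longleftrightarrow>
     (\<forall>n. S n \<in> measurable N (count_space UNIV)) \<and>
     (AE \<omega> in N. S 0 \<omega> = 0) \<and>
     prob_space.indep_vars N (\<lambda>_. count_space UNIV) (\<lambda>n \<omega>. S (Suc n) \<omega> - S n \<omega>) UNIV \<and>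
     (\<forall>n. measure N {\<omega> \<in> space N. S (Suc n) \<omega> - S n \<omega> = 1} = 1 / 2 \<and>
          measure N {\<omega> \<in> space N. S (Suc n) \<omega> - S n \<omega> = - 1} = 1 / 2)"

(* \<infinity> if the level is never reached, since Inf {} = \<infinity> in enat. *)
definition first_hit :: "(nat \<Rightarrow> int) \<Rightarrow> int \<Rightarrow> enat" where
  "first_hit s x = Inf (enat ` {n. s n = x})"

end

theory Submission
  imports Defs "HOL-Real_Asymp.Real_Asymp"
begin

text \<open>
  Follow an interval of sites backwards in time: a nonempty interval (a, b] contains a particle at
  time n + 1 iff (a', b'] contains one at time n, where each endpoint moves one step to the left if
  its update is rightward. The two endpoints use different updates, so the length of the interval is
  a lazy random walk with steps -1, 0, 1 of probabilities 1/4, 1/2, 1/4, absorbed at 0, i.e. half of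
  a simple random walk observed at even times. For a single site it starts from 1, hence the simple
  walk starts at distance 2 from its absorbing state. The closed form of the survival probability is
  the reflection principle, and the asymptotics come from Wallis' product.
\<close>

section \<open>Survival probabilities of the simple random walk\<close>

text \<open>A real recursion for the law of the walk, free of any probability space. The random walk
  and the particle system are tied to it later by showing that their probabilities obey the
  recursions of \<open>survival\<close>.\<close>

primrec walk_pmf :: "nat \<Rightarrow> int \<Rightarrow> real" where
  "walk_pmf 0 = (\<lambda>x. if x = 0 then 1 else 0)"
| "walk_pmf (Suc m) = (\<lambda>x. (walk_pmf m (x - 1) + walk_pmf m (x + 1)) / 2)"

text \<open>By the reflection principle, the walk stays below j > 0 up to time m with the
  probability that it lies in [-j, j) at time m.\<close>

definition survival :: "nat \<Rightarrow> int \<Rightarrow> real" where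
  "survival m j = (\<Sum>x\<in>{-j..<j}. walk_pmf m x)"

lemma survival_0: "j > 0 \<Longrightarrow> survival 0 j = 1"
  by (simp add: survival_def)

lemma survival_zero_level [simp]: "survival m 0 = 0"
  by (simp add: survival_def)

lemma sum_shift_int: "(\<Sum>x\<in>{a..<b}. f (x + c)) = (\<Sum>x\<in>{a + c..<b + c}. f x)" for a b c :: int
  by (rule sum.reindex_bij_witness[of _ "\<lambda>x. x - c" "\<lambda>x. x + c"]) auto

text \<open>The two terms of \<open>walk_pmf\<close> shift the window \<open>{-j..<j}\<close> by one
  site to either side. Exchanging the right ends of the shifted windows gives the windows of levels
  \<open>j - 1\<close> and \<open>j + 1\<close>. With \<open>survival_zero_level\<close> this is
  first-step analysis with absorption at 0.\<close>

lemma survival_Suc: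
  assumes "j > 0"
  shows "survival (Suc m) j = (survival m (j - 1) + survival m (j + 1)) / 2"
proof -
  let ?S = "\<lambda>a b. \<Sum>x\<in>{a..<b}. walk_pmf m x"
  have split: "?S a c = ?S a b + ?S b c" if "a \<le> b" "b \<le> c" for a b c
    using that by (subst sum.union_disjoint[symmetric]) (auto simp: ivl_disj_un)
  have "2 * survival (Suc m) j = ?S (-j - 1) (j - 1) + ?S (-j + 1) (j + 1)"
    using sum_shift_int[of "walk_pmf m" "-1" "-j" j] sum_shift_int[of "walk_pmf m" 1 "-j" j]
    by (simp add: survival_def sum.distrib flip: sum_divide_distrib)
  also have "\<dots> = ?S (-j + 1) (j - 1) + ?S (-j - 1) (j + 1)"
    using assms split[of "-j - 1" "j - 1" "j + 1"] split[of "-j + 1" "j - 1" "j + 1"] by simp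
  also have "\<dots> = survival m (j - 1) + survival m (j + 1)"
    by (simp add: survival_def)
  finally show ?thesis
    by simp
qed

text \<open>Two steps at once: the recursion that the length \<open>j\<close> of an interval
  followed backwards will satisfy.\<close>

lemma survival_even_Suc:
  assumes "j > 0"
  shows "survival (2 * Suc n) (2 * j) =
    (survival (2 * n) (2 * (j - 1)) + 2 * survival (2 * n) (2 * j) + survival (2 * n) (2 * (j + 1))) / 4"
  using assms by (simp add: survival_Suc field_simps)

section \<open>Closed form at level 2 and its asymptotics\<close>

lemma walk_pmf_eq_0: "x < - int m \<or> odd (int m + x) \<Longrightarrow> walk_pmf m x = 0"
  by (induction m arbitrary: x) auto

lemma walk_pmf_binomial: "walk_pmf m (2 * int k - int m) = real (m choose k) / 2 ^ m"
proof (induction m arbitrary: k)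
  case (Suc m)
  have up: "walk_pmf m (2 * int k - int (Suc m) + 1) = real (m choose k) / 2 ^ m"
    using Suc[of k] by (simp add: algebra_simps)
  show ?case
  proof (cases k)
    case 0
    then show ?thesis using up walk_pmf_eq_0[of "- 2 - int m" m] by simp
  next
    case (Suc l)
    have "2 * int k - int (Suc m) - 1 = 2 * int l - int m"
      using Suc by simp
    then show ?thesis using up Suc.IH[of l] Suc by (simp add: field_simps)
  qed
qed simp

text \<open>By parity only the sites -2 and 0 of the window carry mass at an even time; Pascal's
  rule adds their two binomials.\<close>

lemma survival_even_2: "survival (2 * n) 2 = real ((2 * n + 1) choose n) / 4 ^ n"
proof -
  have "{-2..<2} = {-2, -1, 0, 1 :: int}"
    by auto
  then have "survival (2 * n) 2 = walk_pmf (2 * n) (-2) + walk_pmf (2 * n) 0"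
    by (simp add: survival_def walk_pmf_eq_0)
  also have "walk_pmf (2 * n) 0 = real ((2 * n) choose n) / 4 ^ n"
    using walk_pmf_binomial[of "2 * n" n] by (simp add: power_mult)
  also have "walk_pmf (2 * n) (-2) + \<dots> = real ((2 * n + 1) choose n) / 4 ^ n"
  \<comment> \<open>For \<open>n = Suc l\<close> the site -2 is reached by \<open>l\<close> steps
    up; for \<open>n = 0\<close> it is not reached at all.\<close>
  proof (cases n)
    case (Suc l)
    then show ?thesis
      using walk_pmf_binomial[of "2 * n" l] by (simp add: power_mult add_divide_distrib del: walk_pmf.simps)
  qed simp
  finally show ?thesis .
qed

text \<open>An exact identity with the partial Wallis products. As these tend to
  \<open>pi / 2\<close>, the squared survival probability behaves like
  \<open>4 / (pi * n)\<close>.\<close>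

lemma survival_wallis:
  "(survival (2 * n) 2)\<^sup>2 * (\<Prod>k = 1..n. 4 * (real k)\<^sup>2 / (4 * (real k)\<^sup>2 - 1)) * (real n + 1)\<^sup>2
     = 2 * real n + 1"
proof (induction n)
  case 0
  show ?case by (simp add: survival_0)
next
  case (Suc n)
  define c where "c n = real ((2 * n + 1) choose n)" for n
  \<comment> \<open>Two absorption identities, meeting at \<open>(2 * n + 2) choose n\<close>, give
    the ratio of consecutive central coefficients.\<close>
  have "Suc n * (Suc (2 * n + 2) choose Suc n) = (2 * n + 3) * ((2 * n + 2) choose n)"
  proof -
    have "2 * n + 3 = Suc (2 * n + 2)"
      by simp
    then show ?thesis
      using Suc_times_binomial_eq[of "2 * n + 2" n] by (simp only: mult.commute)
  qed
  moreover have "(n + 2) * ((2 * n + 2) choose n) = (2 * n + 2) * ((2 * n + 1) choose n)"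
    using binomial_absorb_comp[of "2 * n + 2" n] by simp
  ultimately have "(n + 2) * (Suc n * (Suc (2 * n + 2) choose Suc n))
      = (2 * n + 3) * ((2 * n + 2) * ((2 * n + 1) choose n))"
    by (metis mult.left_commute)
  then have "Suc n * ((n + 2) * (Suc (2 * n + 2) choose Suc n))
      = Suc n * ((2 * n + 3) * (2 * ((2 * n + 1) choose n)))"
    by (simp only: ac_simps) (simp add: algebra_simps)
  then have "(n + 2) * ((2 * Suc n + 1) choose Suc n) = (4 * n + 6) * ((2 * n + 1) choose n)"
    by (simp only: mult_cancel1) (simp add: algebra_simps)
  then have "real ((n + 2) * ((2 * Suc n + 1) choose Suc n)) = real ((4 * n + 6) * ((2 * n + 1) choose n))"
    by (rule arg_cong)
  then have "(real n + 2) * c (Suc n) = (4 * real n + 6) * c n"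
    unfolding c_def by (simp only: of_nat_mult of_nat_add of_nat_numeral)
  then have "c (Suc n) = c n * (2 * (2 * real n + 3)) / (real n + 2)"
    by (simp add: eq_divide_eq algebra_simps)
  then have c_Suc: "survival (2 * Suc n) 2 = survival (2 * n) 2 * ((2 * real n + 3) / (2 * (real n + 2)))"
    unfolding survival_even_2 c_def[symmetric] by (simp add: divide_simps) (simp add: algebra_simps)
  define P where "P = (\<Prod>k = 1..n. 4 * (real k)\<^sup>2 / (4 * (real k)\<^sup>2 - 1))"
  have P_Suc: "(\<Prod>k = 1..Suc n. 4 * (real k)\<^sup>2 / (4 * (real k)\<^sup>2 - 1))
      = P * (4 * (real (Suc n))\<^sup>2 / (4 * (real (Suc n))\<^sup>2 - 1))"
    by (simp add: P_def del: of_nat_Suc)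
  \<comment> \<open>The new Wallis factor is
    \<open>4 * (n + 1)^2 / ((2 * n + 1) * (2 * n + 3))\<close>, so all factors \<open>n + 2\<close>
    cancel and the right-hand side of the claim advances from \<open>2 * n + 1\<close> to
    \<open>2 * n + 3\<close>.\<close>
  have quot: "((2 * real n + 3) / (2 * (real n + 2)))\<^sup>2
      * (4 * (real (Suc n))\<^sup>2 / (4 * (real (Suc n))\<^sup>2 - 1)) * (real (Suc n) + 1)\<^sup>2
      = (real n + 1)\<^sup>2 * ((2 * real n + 3) / (2 * real n + 1))"
  proof -
    have "4 * (real (Suc n))\<^sup>2 - 1 = (2 * real n + 1) * (2 * real n + 3)"
      by (simp add: power2_eq_square algebra_simps)
    moreover have "2 * real n + 1 \<noteq> 0" "2 * real n + 3 \<noteq> 0" "real n + 2 \<noteq> 0"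
      by linarith+
    ultimately show ?thesis
      by (simp add: divide_simps) (simp add: power2_eq_square algebra_simps)
  qed
  have "(survival (2 * Suc n) 2)\<^sup>2 * (\<Prod>k = 1..Suc n. 4 * (real k)\<^sup>2 / (4 * (real k)\<^sup>2 - 1))
      * (real (Suc n) + 1)\<^sup>2
      = (survival (2 * n) 2)\<^sup>2 * P * (((2 * real n + 3) / (2 * (real n + 2)))\<^sup>2
        * (4 * (real (Suc n))\<^sup>2 / (4 * (real (Suc n))\<^sup>2 - 1)) * (real (Suc n) + 1)\<^sup>2)"
    unfolding c_Suc P_Suc power_mult_distrib[of "survival (2 * n) 2"] by (simp only: mult_ac)
  also have "\<dots> = ((survival (2 * n) 2)\<^sup>2 * P * (real n + 1)\<^sup>2) * ((2 * real n + 3) / (2 * real n + 1))"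
    unfolding quot by (simp add: mult_ac)
  also have "\<dots> = 2 * real (Suc n) + 1"
    using Suc.IH unfolding P_def by (simp add: field_simps)
  finally show ?case .
qed

lemma survival_nonneg: "survival m j \<ge> 0"
proof -
  have "walk_pmf m x \<ge> 0" for x
    by (induction m arbitrary: x) (auto intro!: add_nonneg_nonneg)
  then show ?thesis by (simp add: survival_def sum_nonneg)
qed

lemma survival_asymp_equiv:
  "(\<lambda>n. survival (2 * n) 2) \<sim>[sequentially] (\<lambda>n. 2 / sqrt (pi * real n))"
proof (rule asymp_equivI')
  define P where "P n = (\<Prod>k = 1..n. 4 * (real k)\<^sup>2 / (4 * (real k)\<^sup>2 - 1))" for n
  \<comment> \<open>The radicand is the square of the ratio to be estimated, with
    \<open>survival\<close> eliminated by \<open>survival_wallis\<close>. The limit equals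
    1.\<close>
  have lim: "(\<lambda>n. sqrt ((2 * real n + 1) * real n / (real n + 1)\<^sup>2 * (pi / 4) * inverse (P n)))
      \<longlonglongrightarrow> sqrt (2 * (pi / 4) * inverse (pi / 2))"
    using wallis unfolding P_def[symmetric]
    by (intro tendsto_intros) (real_asymp, auto)
  have "sqrt ((2 * real n + 1) * real n / (real n + 1)\<^sup>2 * (pi / 4) * inverse (P n))
      = survival (2 * n) 2 / (2 / sqrt (pi * real n))" if "n > 0" for n
  proof -
    have eq: "(survival (2 * n) 2)\<^sup>2 * P n * (real n + 1)\<^sup>2 = 2 * real n + 1"
      using survival_wallis unfolding P_def .
    then have "P n \<noteq> 0" by auto
    moreover have "real n + 1 \<noteq> 0" by linarith
    ultimately have "(2 * real n + 1) * real n / (real n + 1)\<^sup>2 * (pi / 4) * inverse (P n)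
        = (survival (2 * n) 2)\<^sup>2 * (pi * real n) / 4"
      unfolding eq[symmetric] by (simp add: field_simps)
    also have "sqrt \<dots> = survival (2 * n) 2 * sqrt (pi * real n) / 2"
      using survival_nonneg by (simp add: real_sqrt_divide real_sqrt_mult)
    finally show ?thesis by simp
  qed
  then have "eventually (\<lambda>n. sqrt ((2 * real n + 1) * real n / (real n + 1)\<^sup>2 * (pi / 4) * inverse (P n))
      = survival (2 * n) 2 / (2 / sqrt (pi * real n))) sequentially"
    by (rule eventually_mono[OF eventually_gt_at_top[of 0]])
  from Lim_transform_eventually[OF lim this]
  show "(\<lambda>n. survival (2 * n) 2 / (2 / sqrt (pi * real n))) \<longlonglongrightarrow> 1"
    by simp
qed

section \<open>Independence of disjoint blocks of coordinates\<close>

text \<open>Restrictions of an independent family to disjoint blocks are independent.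
  \<open>P_restrict\<close> and \<open>Q_restrict\<close> allow the predicates to be evaluated at
  the whole family instead of its blocks. The second conclusion is also used for measurability
  alone, with \<open>B = {}\<close> and a trivial \<open>Q\<close>.\<close>

lemma (in prob_space) prob_disjoint_coordinates:
  fixes X :: "'i \<Rightarrow> 'a \<Rightarrow> 'v"
  assumes ind: "indep_vars (\<lambda>_. count_space UNIV) X UNIV" and "A \<inter> B = {}"
    and P: "Measurable.pred (\<Pi>\<^sub>M i\<in>A. count_space UNIV) P"
    and Q: "Measurable.pred (\<Pi>\<^sub>M i\<in>B. count_space UNIV) Q"
    and P_restrict: "\<And>u. P (restrict u A) = P u" and Q_restrict: "\<And>u. Q (restrict u B) = Q u"
  shows "prob {\<omega> \<in> space M. P (\<lambda>i. X i \<omega>) \<and> Q (\<lambda>i. X i \<omega>)}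
    = prob {\<omega> \<in> space M. P (\<lambda>i. X i \<omega>)} * prob {\<omega> \<in> space M. Q (\<lambda>i. X i \<omega>)}"
    and "{\<omega> \<in> space M. P (\<lambda>i. X i \<omega>)} \<in> events"
proof -
  let ?M = "\<lambda>A. \<Pi>\<^sub>M i\<in>A. count_space (UNIV :: 'v set)"
  let ?X = "\<lambda>A \<omega>. restrict (\<lambda>i. X i \<omega>) A"
  have iv: "indep_var (?M A) (?X A) (?M B) (?X B)"
    using ind \<open>A \<inter> B = {}\<close> by (rule indep_var_restrict) auto
  have meas: "?X A \<in> measurable M (?M A)"
    using indep_var_rv1[OF iv] .
  have "prob ((\<lambda>\<omega>. (?X A \<omega>, ?X B \<omega>)) -` ({u \<in> space (?M A). P u} \<times> {u \<in> space (?M B). Q u}) \<inter> space M)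
    = prob (?X A -` {u \<in> space (?M A). P u} \<inter> space M) * prob (?X B -` {u \<in> space (?M B). Q u} \<inter> space M)"
    using P Q by (intro indep_varD[OF iv]) (auto simp: pred_def)
  moreover have "?X A -` {u \<in> space (?M A). P u} \<inter> space M = {\<omega> \<in> space M. P (\<lambda>i. X i \<omega>)}"
    using P_restrict by (auto simp: space_PiM)
  moreover have "?X B -` {u \<in> space (?M B). Q u} \<inter> space M = {\<omega> \<in> space M. Q (\<lambda>i. X i \<omega>)}"
    using Q_restrict by (auto simp: space_PiM)
  moreover have "(\<lambda>\<omega>. (?X A \<omega>, ?X B \<omega>)) -` ({u \<in> space (?M A). P u} \<times> {u \<in> space (?M B). Q u}) \<inter> space M
      = {\<omega> \<in> space M. P (\<lambda>i. X i \<omega>) \<and> Q (\<lambda>i. X i \<omega>)}"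
    using P_restrict Q_restrict by (auto simp: space_PiM)
  ultimately show "prob {\<omega> \<in> space M. P (\<lambda>i. X i \<omega>) \<and> Q (\<lambda>i. X i \<omega>)}
    = prob {\<omega> \<in> space M. P (\<lambda>i. X i \<omega>)} * prob {\<omega> \<in> space M. Q (\<lambda>i. X i \<omega>)}"
    by simp
  have "?X A -` {u \<in> space (?M A). P u} \<inter> space M \<in> events"
    using P by (intro measurable_sets[OF meas]) (auto simp: pred_def)
  then show "{\<omega> \<in> space M. P (\<lambda>i. X i \<omega>)} \<in> events"
    using P_restrict by (auto simp: space_PiM vimage_def Int_def conj_commute)
qed

section \<open>Measurability of operations on countable types\<close>

lemma measurable_binop_count_space:
  fixes f :: "'a \<Rightarrow> 'b :: countable" and g :: "'a \<Rightarrow> 'c :: countable"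
  assumes "f \<in> measurable M (count_space UNIV)" "g \<in> measurable M (count_space UNIV)"
  shows "(\<lambda>x. h (f x) (g x)) \<in> measurable M (count_space UNIV)"
proof -
  have "(\<lambda>x. h i (g x)) \<in> measurable M (count_space UNIV)" for i
    using assms(2) by (rule measurable_compose) simp
  from measurable_compose_countable[OF this assms(1)] show ?thesis .
qed

lemma measurable_sum_count_space:
  fixes f :: "'i \<Rightarrow> 'a \<Rightarrow> 'b :: {countable, comm_monoid_add}"
  assumes "\<And>i. i \<in> I \<Longrightarrow> f i \<in> measurable M (count_space UNIV)"
  shows "(\<lambda>x. \<Sum>i\<in>I. f i x) \<in> measurable M (count_space UNIV)"
  using assms
  by (induction I rule: infinite_finite_induct)
     (auto intro!: measurable_binop_count_space[where h = "(+)"])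

section \<open>The hitting time of the simple random walk\<close>

lemma first_hit_greater_iff: "first_hit s x > enat m \<longleftrightarrow> (\<forall>k\<le>m. s k \<noteq> x)"
proof -
  \<comment> \<open>A lower bound for an infimum is a bound for every element, which also covers a
    level that is never reached.\<close>
  have "first_hit s x > enat m \<longleftrightarrow> enat (Suc m) \<le> first_hit s x"
    by (metis Suc_ile_eq)
  also have "\<dots> \<longleftrightarrow> (\<forall>k. s k = x \<longrightarrow> m < k)"
    by (auto simp: first_hit_def le_Inf_iff Suc_le_eq)
  also have "\<dots> \<longleftrightarrow> (\<forall>k\<le>m. s k \<noteq> x)"
    by (metis not_le)
  finally show ?thesis .
qed

text \<open>First-step analysis: after the increment \<open>x\<close> the later increments must
  avoid level \<open>j - x\<close>, which reproduces \<open>survival_Suc\<close>. The offset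
  \<open>s\<close> makes the induction hypothesis apply to those later increments.\<close>

lemma (in prob_space) prob_walk_avoids:
  fixes \<xi> :: "nat \<Rightarrow> 'a \<Rightarrow> int"
  assumes ind: "indep_vars (\<lambda>_. count_space UNIV) \<xi> UNIV"
    and up: "\<And>i. prob {\<omega> \<in> space M. \<xi> i \<omega> = 1} = 1 / 2"
    and down: "\<And>i. prob {\<omega> \<in> space M. \<xi> i \<omega> = -1} = 1 / 2"
    and "j \<ge> 0"
  shows "prob {\<omega> \<in> space M. \<forall>k\<le>m. (\<Sum>i<k. \<xi> (s + i) \<omega>) \<noteq> j} = survival m j"
  using \<open>j \<ge> 0\<close>
proof (induction m arbitrary: s j)
  case 0
  have "(\<forall>k\<le>0. (\<Sum>i<k. \<xi> (s + i) \<omega>) \<noteq> j) \<longleftrightarrow> j \<noteq> 0" for \<omega>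
    by (simp only: le_zero_eq) auto
  with 0 show ?case by (cases "j = 0") (simp_all only: prob_space survival_0, simp_all add: prob_space survival_0)
next
  case (Suc m)
  have rv [measurable]: "\<xi> i \<in> measurable M (count_space UNIV)" for i
    using ind by (auto simp: indep_vars_def)
  define avoids where "avoids s m j u \<longleftrightarrow> (\<forall>k\<le>m. (\<Sum>i<k. u (s + i)) \<noteq> j)"
    for s m and j :: int and u :: "nat \<Rightarrow> int"
  show ?case
  proof (cases "j = 0")
    case True
    then have "\<not> (\<forall>k\<le>Suc m. (\<Sum>i<k. \<xi> (s + i) \<omega>) \<noteq> j)" for \<omega>
      by (auto intro!: exI[of _ 0])
    then have "{\<omega> \<in> space M. \<forall>k\<le>Suc m. (\<Sum>i<k. \<xi> (s + i) \<omega>) \<noteq> j} = {}"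
      by blast
    with True show ?thesis
      by (simp only: measure_empty survival_zero_level)
  next
    case False
    with Suc.prems have "j > 0" by simp
    \<comment> \<open>The empty sum at \<open>k = 0\<close> misses \<open>j\<close> because
      \<open>j > 0\<close>; every other sum loses its first increment.\<close>
    have step: "avoids s (Suc m) j u \<longleftrightarrow> avoids (Suc s) m (j - u s) u" for u
    proof -
      have "(\<forall>k\<le>Suc m. p k) \<longleftrightarrow> p 0 \<and> (\<forall>k\<le>m. p (Suc k))" for p
        by (metis Suc_le_mono not0_implies_Suc zero_le)
      then have "avoids s (Suc m) j u \<longleftrightarrow>
          (\<Sum>i<0. u (s + i)) \<noteq> j \<and> (\<forall>k\<le>m. (\<Sum>i<Suc k. u (s + i)) \<noteq> j)"
        unfolding avoids_def .
      moreover have "(\<Sum>i<Suc k. u (s + i)) = u s + (\<Sum>i<k. u (Suc s + i))" for k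
        by (subst sum.lessThan_Suc_shift) simp
      ultimately show ?thesis
        using \<open>j > 0\<close> unfolding avoids_def by (simp add: eq_diff_eq add.commute del: sum.lessThan_Suc)
    qed
    have rest: "Measurable.pred (\<Pi>\<^sub>M i\<in>{Suc s..}. count_space UNIV) (avoids (Suc s) m j)" for j
      unfolding avoids_def
    proof -
      have "(\<lambda>u. \<Sum>i<k. u (Suc s + i)) \<in> measurable (\<Pi>\<^sub>M i\<in>{Suc s..}. count_space UNIV) (count_space (UNIV :: int set))" for k
        by (intro measurable_sum_count_space measurable_component_singleton) auto
      then show "Measurable.pred (\<Pi>\<^sub>M i\<in>{Suc s..}. count_space UNIV) (\<lambda>u. \<forall>k\<le>m. (\<Sum>i<k. u (Suc s + i)) \<noteq> j)"
        by measurable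
    qed
    have first: "Measurable.pred (\<Pi>\<^sub>M i\<in>{s}. count_space UNIV) (\<lambda>u. u s = (x :: int))" for x
      by measurable
    let ?E = "\<lambda>x. {\<omega> \<in> space M. \<xi> s \<omega> = x \<and> avoids (Suc s) m (j - x) (\<lambda>i. \<xi> i \<omega>)}"
    \<comment> \<open>Increment \<open>s\<close> and the increments from \<open>Suc s\<close> on are
      disjoint blocks. For these \<open>x\<close> the level \<open>j - x\<close> stays nonnegative,
      as the induction hypothesis requires.\<close>
    have E: "prob (?E x) = prob {\<omega> \<in> space M. \<xi> s \<omega> = x} * survival m (j - x)" if "x \<in> {1, -1}" for x
    proof -
      have "prob (?E x) = prob {\<omega> \<in> space M. \<xi> s \<omega> = x} * prob {\<omega> \<in> space M. avoids (Suc s) m (j - x) (\<lambda>i. \<xi> i \<omega>)}"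
        by (rule prob_disjoint_coordinates(1)[OF ind _ first rest])
           (auto simp: avoids_def)
      with Suc.IH[of "j - x" "Suc s"] that \<open>j > 0\<close> show ?thesis
        by (auto simp: avoids_def)
    qed
    have avoids_events [measurable]: "Measurable.pred M (\<lambda>\<omega>. avoids s m j (\<lambda>i. \<xi> i \<omega>))" for s m j
    proof -
      have "(\<lambda>\<omega>. \<Sum>i<k. \<xi> (s + i) \<omega>) \<in> measurable M (count_space UNIV)" for k
        by (intro measurable_sum_count_space rv)
      then show ?thesis
        unfolding avoids_def by measurable
    qed
    \<comment> \<open>Two disjoint events of probability 1/2 leave only a null set for other
      increments.\<close>
    have "prob ({\<omega> \<in> space M. \<xi> s \<omega> = 1} \<union> {\<omega> \<in> space M. \<xi> s \<omega> = -1}) = 1"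
      by (subst finite_measure_Union) (auto simp: up down)
    then have ae: "AE \<omega> in M. \<xi> s \<omega> = 1 \<or> \<xi> s \<omega> = -1"
      by (subst (asm) prob_eq_1) (auto)
    have "prob {\<omega> \<in> space M. avoids s (Suc m) j (\<lambda>i. \<xi> i \<omega>)} = prob (?E 1 \<union> ?E (-1))"
      using ae by (intro measure_eq_AE) (auto simp: step)
    also have "\<dots> = prob (?E 1) + prob (?E (-1))"
      by (rule finite_measure_Union) auto
    also have "\<dots> = survival (Suc m) j"
      using E[of 1] E[of "-1"] \<open>j > 0\<close> by (simp add: up down survival_Suc)
    finally show ?thesis by (simp add: avoids_def)
  qed
qed

lemma prob_first_hit_greater:
  assumes "prob_space N" and walk: "simple_symmetric_random_walk N S" and "j \<ge> 0"
  shows "measure N {\<omega> \<in> space N. first_hit (\<lambda>m. S m \<omega>) j > enat m} = survival m j"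
proof -
  interpret N: prob_space N by fact
  have [measurable]: "S n \<in> measurable N (count_space UNIV)" for n
    using walk by (auto simp: simple_symmetric_random_walk_def)
  have "AE \<omega> in N. S 0 \<omega> = 0"
    using walk by (auto simp: simple_symmetric_random_walk_def)
  \<comment> \<open>The form \<open>0 + i\<close> matches \<open>prob_walk_avoids\<close> at offset
    \<open>s = 0\<close>.\<close>
  moreover have "(\<Sum>i<k. S (Suc (0 + i)) \<omega> - S (0 + i) \<omega>) = S k \<omega> - S 0 \<omega>" for k \<omega>
    using sum_lessThan_telescope[of "\<lambda>i. S i \<omega>" k] by simp
  ultimately have "measure N {\<omega> \<in> space N. first_hit (\<lambda>m. S m \<omega>) j > enat m}
      = measure N {\<omega> \<in> space N. \<forall>k\<le>m. (\<Sum>i<k. S (Suc (0 + i)) \<omega> - S (0 + i) \<omega>) \<noteq> j}"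
    by (intro measure_eq_AE) (auto simp: first_hit_greater_iff simp del: add_0)
  also have "\<dots> = survival m j"
    using walk \<open>j \<ge> 0\<close>
    by (intro N.prob_walk_avoids[where \<xi> = "\<lambda>n \<omega>. S (Suc n) \<omega> - S n \<omega>" and s = 0])
       (auto simp: simple_symmetric_random_walk_def)
  finally show ?thesis .
qed

section \<open>Coalescing particles\<close>

text \<open>Merging never empties a site, so the four cases of the definition reduce to a jump from
  the left or a stay.\<close>

lemma coalesce_eq_Occupied_iff:
  "coalesce z u i = Occupied \<longleftrightarrow>
     z (i - 1) = Occupied \<and> u (i - 1) = Rightward \<or> z i = Occupied \<and> u i = Up"
  unfolding coalesce_def by (cases "z (i - 1)"; cases "z i"; cases "u (i - 1)"; cases "u i") auto

definition retreat :: "update \<Rightarrow> int" where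
  "retreat x = (if x = Up then 0 else 1)"

text \<open>Only the ends matter: a particle at \<open>a\<close> enters iff
  \<open>u a = Rightward\<close>, one at \<open>b\<close> leaves iff \<open>u b = Rightward\<close>,
  and those strictly between remain inside. \<open>a < b\<close> ensures that a particle leaving
  \<open>a\<close> lands inside.\<close>

lemma coalesce_interval_iff:
  assumes "a < b"
  shows "(\<exists>i\<in>{a<..b}. coalesce z u i = Occupied) \<longleftrightarrow>
    (\<exists>i\<in>{a - retreat (u a)<..b - retreat (u b)}. z i = Occupied)"
proof
  assume "\<exists>i\<in>{a<..b}. coalesce z u i = Occupied"
  then obtain i where i: "a < i" "i \<le> b"
    "z (i - 1) = Occupied \<and> u (i - 1) = Rightward \<or> z i = Occupied \<and> u i = Up"
    by (auto simp: coalesce_eq_Occupied_iff)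
  from i(3) show "\<exists>i\<in>{a - retreat (u a)<..b - retreat (u b)}. z i = Occupied"
  proof
    assume "z (i - 1) = Occupied \<and> u (i - 1) = Rightward"
    with i show ?thesis
      by (intro bexI[of _ "i - 1"]) (cases "i - 1 = a"; auto simp: retreat_def)+
  next
    assume "z i = Occupied \<and> u i = Up"
    with i show ?thesis
      by (intro bexI[of _ i]) (cases "i = b"; auto simp: retreat_def)+
  qed
next
  assume "\<exists>i\<in>{a - retreat (u a)<..b - retreat (u b)}. z i = Occupied"
  then obtain i where i: "a - retreat (u a) < i" "i \<le> b - retreat (u b)" "z i = Occupied"
    by auto
  show "\<exists>i\<in>{a<..b}. coalesce z u i = Occupied"
  proof (cases "u i")
    case Up
    with i show ?thesis
      by (intro bexI[of _ i]) (cases "i = a"; auto simp: retreat_def coalesce_eq_Occupied_iff split: if_splits)+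
  next
    case Rightward
    with i \<open>a < b\<close> show ?thesis
      by (intro bexI[of _ "i + 1"]) (cases "i = b"; auto simp: retreat_def coalesce_eq_Occupied_iff split: if_splits)+
  qed
qed

text \<open>The process as a deterministic function of the updates: its state at time
  \<open>n\<close> uses only updates before \<open>n\<close>, so it is independent of those at time
  \<open>n\<close>.\<close>

primrec config :: "nat \<Rightarrow> (int \<times> nat \<Rightarrow> update) \<Rightarrow> int \<Rightarrow> cell" where
  "config 0 u = (\<lambda>_. Occupied)"
| "config (Suc n) u = coalesce (config n u) (\<lambda>i. u (i, n))"

lemma config_cong:
  "(\<And>i m. m < n \<Longrightarrow> u (i, m) = v (i, m)) \<Longrightarrow> config n u = config n v"
  by (induction n) auto

lemma measurable_config:
  "UNIV \<times> {..<n} \<subseteq> A \<Longrightarrow>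
    Measurable.pred (\<Pi>\<^sub>M p\<in>A. count_space UNIV) (\<lambda>u. config n u k = Occupied)"
proof (induction n arbitrary: k)
  case (Suc n)
  have [measurable]: "Measurable.pred (\<Pi>\<^sub>M p\<in>A. count_space UNIV) (\<lambda>u. config n u k = Occupied)" for k
    using Suc.prems by (intro Suc.IH) auto
  have [measurable]: "(\<lambda>u. u (i, n)) \<in> measurable (\<Pi>\<^sub>M p\<in>A. count_space UNIV) (count_space (UNIV :: update set))" for i
    using Suc.prems by (intro measurable_component_singleton) auto
  show ?case
    unfolding config.simps coalesce_eq_Occupied_iff by measurable
qed simp

text \<open>Conditioning on the two endpoint updates of the last step reproduces
  \<open>survival_even_Suc\<close>. Empty intervals are included because the backward interval may
  shrink to one; they correspond to the absorbed walk.\<close>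

lemma (in prob_space) prob_config_interval:
  fixes X :: "int \<times> nat \<Rightarrow> 'a \<Rightarrow> update"
  assumes ind: "indep_vars (\<lambda>_. count_space UNIV) X UNIV"
    and half: "\<And>p x. prob {\<omega> \<in> space M. X p \<omega> = x} = 1 / 2"
    and "a \<le> b"
  shows "prob {\<omega> \<in> space M. \<exists>i\<in>{a<..b}. config n (\<lambda>p. X p \<omega>) i = Occupied} = survival (2 * n) (2 * (b - a))"
  using \<open>a \<le> b\<close>
proof (induction n arbitrary: a b)
  case 0
  moreover have "\<exists>i>a. i \<le> b" if "a < b"
    using that by auto
  ultimately show ?case by (cases "a = b") (auto simp: prob_space survival_0)
next
  case (Suc n)
  show ?case
  proof (cases "a = b")
    case True
    then show ?thesis by simp
  next
    case False
    with Suc.prems have "a < b" by simp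
    let ?past = "\<lambda>a b u. \<exists>i\<in>{a<..b}. config n u i = Occupied"
    let ?new = "\<lambda>x y u. u (a, n) = x \<and> u (b, n) = y"
    define E where "E = (\<lambda>(x, y). {\<omega> \<in> space M. ?past (a - retreat x) (b - retreat y) (\<lambda>p. X p \<omega>)
        \<and> ?new x y (\<lambda>p. X p \<omega>)})"
    have rv [measurable]: "X p \<in> measurable M (count_space UNIV)" for p
      using ind unfolding indep_vars_def by blast
    have past_pred: "Measurable.pred (\<Pi>\<^sub>M p\<in>UNIV \<times> {..<n}. count_space UNIV) (?past a b)" for a b
    proof -
      have [measurable]: "Measurable.pred (\<Pi>\<^sub>M p\<in>UNIV \<times> {..<n}. count_space UNIV) (\<lambda>u. config n u k = Occupied)" for k
        by (intro measurable_config) simp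
      show ?thesis by measurable
    qed
    have past_restrict: "?past a b (restrict u (UNIV \<times> {..<n})) = ?past a b u" for a b u
      using config_cong[of n "restrict u (UNIV \<times> {..<n})" u] by simp
    have past_events: "{\<omega> \<in> space M. ?past a b (\<lambda>p. X p \<omega>)} \<in> events" for a b
      by (rule prob_disjoint_coordinates(2)[OF ind _ past_pred, where B = "{}" and Q = "\<lambda>_. True"])
         (auto simp: past_restrict)
    then have [measurable]: "Measurable.pred M (\<lambda>\<omega>. ?past a b (\<lambda>p. X p \<omega>))" for a b
      by (simp add: pred_def)
    have single: "Measurable.pred (\<Pi>\<^sub>M p\<in>{q}. count_space UNIV) (\<lambda>u. u q = x)"
      for q :: "int \<times> nat" and x :: update
      by measurable
    \<comment> \<open>As \<open>a < b\<close>, the endpoint updates are distinct coordinates and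
      hence independent.\<close>
    have new_prob: "prob {\<omega> \<in> space M. ?new x y (\<lambda>p. X p \<omega>)} = 1 / 4" for x y
      using prob_disjoint_coordinates(1)[OF ind _ single single, of "(a, n)" "(b, n)" x y] \<open>a < b\<close>
      by (simp add: half)
    have new_pred: "Measurable.pred (\<Pi>\<^sub>M p\<in>{(a, n), (b, n)}. count_space UNIV) (?new x y)"
      for x y :: update
      by measurable
    have E: "prob (E (x, y)) = survival (2 * n) (2 * (b - retreat y - (a - retreat x))) / 4" for x y
    proof -
      have "prob (E (x, y)) = prob {\<omega> \<in> space M. ?past (a - retreat x) (b - retreat y) (\<lambda>p. X p \<omega>)}
          * prob {\<omega> \<in> space M. ?new x y (\<lambda>p. X p \<omega>)}"
        unfolding E_def prod.case
        by (rule prob_disjoint_coordinates(1)[OF ind _ past_pred new_pred])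
           (auto simp: past_restrict)
      \<comment> \<open>The length drops by at most 1, so the induction hypothesis applies.\<close>
      moreover have "a - retreat x \<le> b - retreat y"
        using \<open>a < b\<close> by (simp add: retreat_def)
      ultimately show ?thesis
        using Suc.IH new_prob by simp
    qed
    let ?I = "{Up, Rightward} \<times> {Up, Rightward}"
    \<comment> \<open>Membership determines the pair of updates, which gives both the decomposition
      and its disjointness.\<close>
    have mem_E: "\<omega> \<in> E p \<longleftrightarrow> p = (X (a, n) \<omega>, X (b, n) \<omega>) \<and> \<omega> \<in> space M \<and>
        ?past (a - retreat (X (a, n) \<omega>)) (b - retreat (X (b, n) \<omega>)) (\<lambda>p. X p \<omega>)" for \<omega> p
      by (cases p) (auto simp: E_def)
    have "{\<omega> \<in> space M. \<exists>i\<in>{a<..b}. config (Suc n) (\<lambda>p. X p \<omega>) i = Occupied} = (\<Union>p. E p)"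
      by (simp add: set_eq_iff coalesce_interval_iff[OF \<open>a < b\<close>] mem_E)
    also have "\<dots> = (\<Union>p\<in>?I. E p)"
    proof -
      have "UNIV = {Up, Rightward}"
        using update.exhaust by blast
      then have "?I = UNIV"
        by (metis UNIV_Times_UNIV)
      then show ?thesis
        by (simp only:)
    qed
    also have "prob \<dots> = (\<Sum>p\<in>?I. prob (E p))"
    proof (rule finite_measure_finite_Union)
      have "E p \<in> events" for p
        unfolding E_def by (cases p) (simp only: prod.case, measurable)
      then show "E ` ?I \<subseteq> events"
        by blast
      show "disjoint_family_on E ?I"
        unfolding disjoint_family_on_def disjoint_iff mem_E by metis
    qed simp
    \<comment> \<open>Equal updates keep the length, hence the middle weight 2; unequal ones change
      it by 1 in either direction.\<close>
    also have "\<dots> = survival (2 * Suc n) (2 * (b - a))"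
      using survival_even_Suc[of "b - a" n] \<open>a < b\<close>
      by (simp add: sum.cartesian_product' E retreat_def algebra_simps)
    finally show ?thesis .
  qed
qed

lemma occupied_prob_eq_survival:
  assumes "prob_space M" and real: "model_C_realization M U Z"
    and init: "AE \<omega> in M. Z 0 \<omega> = (\<lambda>_. Occupied)"
  shows "occupied_prob M Z k n = survival (2 * n) 2"
proof -
  interpret prob_space M by fact
  define X where "X = (\<lambda>(i, n). U i n)"
  have ind: "indep_vars (\<lambda>_. count_space UNIV) X UNIV"
    using real by (simp add: model_C_realization_def update_process_def X_def)
  have half: "prob {\<omega> \<in> space M. X p \<omega> = x} = 1 / 2" for p x
    using real by (cases p; cases x) (auto simp: model_C_realization_def update_process_def X_def)
  \<comment> \<open>Each step of the recursion costs one null set, and only finitely many occur up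
    to time \<open>n\<close>.\<close>
  have ae: "AE \<omega> in M. Z n \<omega> = config n (\<lambda>p. X p \<omega>)"
  proof (induction n)
    case 0
    show ?case using init by simp
  next
    case (Suc n)
    have "AE \<omega> in M. Z (Suc n) \<omega> = coalesce (Z n \<omega>) (\<lambda>i. U i n \<omega>)"
      using real by (simp add: model_C_realization_def)
    with Suc show ?case by eventually_elim (simp add: X_def)
  qed
  have [measurable]: "Z n \<in> measurable M (\<Pi>\<^sub>M i\<in>UNIV. count_space UNIV)"
    using real by (simp add: model_C_realization_def)
  have "{\<omega> \<in> space M. config n (\<lambda>p. X p \<omega>) k = Occupied} \<in> events"
    by (rule prob_disjoint_coordinates(2)[OF ind _ measurable_config[of n UNIV],
          where B = "{}" and Q = "\<lambda>_. True"]) (auto simp: restrict_def)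
  then have "occupied_prob M Z k n = prob {\<omega> \<in> space M. config n (\<lambda>p. X p \<omega>) k = Occupied}"
    unfolding occupied_prob_def using ae by (intro measure_eq_AE) auto
  \<comment> \<open>The site \<open>k\<close> is viewed as an interval of length 1, which
    corresponds to level 2.\<close>
  also have "\<dots> = prob {\<omega> \<in> space M. \<exists>i\<in>{k - 1<..k}. config n (\<lambda>p. X p \<omega>) i = Occupied}"
  proof -
    have "{k - 1<..k} = {k}" by auto
    then show ?thesis by simp
  qed
  also have "\<dots> = survival (2 * n) 2"
    using prob_config_interval[OF ind half, of "k - 1" k n] by simp
  finally show ?thesis .
qed

theorem theorem5p2:
  fixes M :: "'a measure" and N :: "'b measure"
    and U :: "int \<Rightarrow> nat \<Rightarrow> 'a \<Rightarrow> update" and Z :: "nat \<Rightarrow> 'a \<Rightarrow> int \<Rightarrow> cell"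
    and S :: "nat \<Rightarrow> 'b \<Rightarrow> int"
  assumes "prob_space M" and "model_C_realization M U Z"
    and "AE \<omega> in M. Z 0 \<omega> = (\<lambda>_. Occupied)"
    and "prob_space N" and "simple_symmetric_random_walk N S"
  shows "(\<forall>k n. occupied_prob M Z k n = occupied_prob M Z 0 n) \<and>
    (\<forall>n. occupied_prob M Z 0 n
           = measure N {\<omega> \<in> space N. first_hit (\<lambda>m. S m \<omega>) 2 > enat (2 * n)} \<and>
         measure N {\<omega> \<in> space N. first_hit (\<lambda>m. S m \<omega>) 2 > enat (2 * n)}
           = real ((2 * n + 1) choose n) / 4 ^ n) \<and>
    asymp_equiv (\<lambda>n. occupied_prob M Z 0 n) sequentially (\<lambda>n. 2 / sqrt (pi * real n)) \<and>
    (\<lambda>n. occupied_prob M Z 0 n) \<longlonglongrightarrow> 0"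
proof -
  \<comment> \<open>The right-hand side is free of \<open>k\<close>, which yields the independence
    of the site.\<close>
  have occ: "occupied_prob M Z k n = survival (2 * n) 2" for k n
    using assms by (intro occupied_prob_eq_survival)
  have hit: "measure N {\<omega> \<in> space N. first_hit (\<lambda>m. S m \<omega>) 2 > enat (2 * n)} = survival (2 * n) 2" for n
    using assms by (intro prob_first_hit_greater) auto
  have "(\<lambda>n. 2 / sqrt (pi * real n)) \<longlonglongrightarrow> 0"
    by real_asymp
  then have "(\<lambda>n. survival (2 * n) 2) \<longlonglongrightarrow> 0"
    using survival_asymp_equiv asymp_equiv_sym tendsto_asymp_equiv_cong by blast
  then show ?thesis
    using survival_asymp_equiv by (simp only: occ hit survival_even_2[symmetric]) simp
qed

end
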